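(* Let $n\ge 1$ be an integer and let $\mu$ be a Borel probability measure, absolutely continuous with respect to Lebesgue measure, with continuous density $\rho$ taking strictly positive values on its open support $\Omega\subseteq\mathbb R$, and with cumulative distribution function $F$. Let $f:\mathbb R\to\mathbb R^n$ be Borel measurable and differentiable, with measurable derivative $\nabla f$, and such that $\int_\Omega\|f\|^2\,d\mu<+\infty$ and $\int_\Omega\|\nabla f\|^2\,d\mu<+\infty$. Then: (i) The following optimal weighted Poincaré inequality holds: $$\mathrm{Var}_\mu(f)\preceq\frac12\int_\Omega\nabla f(x)\,\nabla f^{T}(x)\,\frac{F(x)(1-F(x))}{[\rho(x)]^2}\,d\mu(x).$$ (ii) The following Poincaré inequality holds: $$\mathrm{Var}_\mu(f)\preceq\min\left(\frac12\sup_{x\in\Omega}\frac{F(x)(1-F(x))}{[\rho(x)]^2},\ 4\left[\sup_{x\in\Omega}\frac{F(x)(1-F(x))}{\rho(x)}\right]^2\right)\int_\Omega\nabla f(x)\,\nabla f^{T}(x)\,d\mu(x).$$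
   Context: Vectors in $\mathbb R^n$ are columns, $T$ denotes transpose, $\|\cdot\|$ is the Euclidean norm. $\mathrm{Var}_\mu(g)=\int_\Omega gg^{T}\,d\mu-\int_\Omega g\,d\mu\int_\Omega g^{T}\,d\mu$. $\Sigma_1\preceq\Sigma_2$ (Loewner order) means that $\Sigma_2-\Sigma_1$ is positive semi-definite. "Optimal" means that, for the given weight $F(1-F)/\rho^2$, the constant $\frac12$ is the best one, in the sense that there exists a function $f_0$ for which the inequality becomes an equality.
   Formalization: The open support Ω is assumed to be connected (an interval); without this the claim fails, e.g. for the uniform law on (0,1)∪(2,3) and a smooth f equal to 0 on (0,1) and 1 on (2,3), where the variance is positive but both right-hand sides vanish. *)

theory Defs
  imports "HOL-Probability.Probability"
begin

definition outer :: "real ^ 'n \<Rightarrow> real ^ 'n \<Rightarrow> real ^ 'n ^ 'n" where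
  "outer u v = (columnvector u :: real ^ 1 ^ 'n) ** (rowvector v :: real ^ 'n ^ 1)"

definition psd :: "real ^ 'n ^ 'n \<Rightarrow> bool" where
  "psd A \<longleftrightarrow> transpose A = A \<and> (\<forall>v. 0 \<le> v \<bullet> (A *v v))"

definition loewner_le :: "real ^ 'n ^ 'n \<Rightarrow> real ^ 'n ^ 'n \<Rightarrow> bool"  (infix \<open>\<preceq>\<^sub>L\<close> 50) where
  "A \<preceq>\<^sub>L B \<longleftrightarrow> psd (B - A)"

definition matrix_variance :: "real measure \<Rightarrow> real set \<Rightarrow> (real \<Rightarrow> real ^ 'n) \<Rightarrow> real ^ 'n ^ 'n" where
  "matrix_variance \<mu> \<Omega> g =
     (LINT x:\<Omega>|\<mu>. outer (g x) (g x)) - outer (LINT x:\<Omega>|\<mu>. g x) (LINT x:\<Omega>|\<mu>. g x)"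

definition weight :: "real measure \<Rightarrow> (real \<Rightarrow> real) \<Rightarrow> real \<Rightarrow> real" where
  "weight \<mu> \<rho> x = cdf \<mu> x * (1 - cdf \<mu> x) / (\<rho> x)\<^sup>2"

text \<open>The suprema may be infinite, so the constant lives in the extended nonnegative reals.\<close>

definition poincare_const :: "real measure \<Rightarrow> (real \<Rightarrow> real) \<Rightarrow> real set \<Rightarrow> ennreal" where
  "poincare_const \<mu> \<rho> \<Omega> =
     min (ennreal (1/2) * (SUP x\<in>\<Omega>. ennreal (cdf \<mu> x * (1 - cdf \<mu> x) / (\<rho> x)\<^sup>2)))
         (4 * (SUP x\<in>\<Omega>. ennreal (cdf \<mu> x * (1 - cdf \<mu> x) / \<rho> x))\<^sup>2)"

text \<open>
  In the next two definitions the right-hand side of the matrix inequality may be infinite. The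
  first conjunct is the Loewner order whenever that side is a genuine real matrix; the second
  gives the inequality its meaning in general, along every direction \<open>v\<close>, in the extended
  nonnegative reals (with \<open>\<infinity> \<cdot> 0 = 0\<close>). The guard in the first conjunct is needed because the
  Bochner integral of a non-integrable function is \<open>0\<close>.
\<close>

definition weighted_poincare ::
    "real measure \<Rightarrow> (real \<Rightarrow> real) \<Rightarrow> real set \<Rightarrow> (real \<Rightarrow> real ^ 'n) \<Rightarrow> (real \<Rightarrow> real ^ 'n) \<Rightarrow> bool" where
  "weighted_poincare \<mu> \<rho> \<Omega> f f' \<longleftrightarrow>
     (set_integrable \<mu> \<Omega> (\<lambda>x. weight \<mu> \<rho> x *\<^sub>R outer (f' x) (f' x)) \<longrightarrow>
        matrix_variance \<mu> \<Omega> f \<preceq>\<^sub>L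
          (1/2) *\<^sub>R (LINT x:\<Omega>|\<mu>. weight \<mu> \<rho> x *\<^sub>R outer (f' x) (f' x))) \<and>
     (\<forall>v. ennreal (v \<bullet> (matrix_variance \<mu> \<Omega> f *v v)) \<le>
          ennreal (1/2) *
            (\<integral>\<^sup>+x\<in>\<Omega>. ennreal (weight \<mu> \<rho> x * (v \<bullet> (outer (f' x) (f' x) *v v))) \<partial>\<mu>))"

definition sup_poincare ::
    "real measure \<Rightarrow> (real \<Rightarrow> real) \<Rightarrow> real set \<Rightarrow> (real \<Rightarrow> real ^ 'n) \<Rightarrow> (real \<Rightarrow> real ^ 'n) \<Rightarrow> bool" where
  "sup_poincare \<mu> \<rho> \<Omega> f f' \<longleftrightarrow>
     (poincare_const \<mu> \<rho> \<Omega> < \<infinity> \<longrightarrow>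
        matrix_variance \<mu> \<Omega> f \<preceq>\<^sub>L
          enn2real (poincare_const \<mu> \<rho> \<Omega>) *\<^sub>R (LINT x:\<Omega>|\<mu>. outer (f' x) (f' x))) \<and>
     (\<forall>v. ennreal (v \<bullet> (matrix_variance \<mu> \<Omega> f *v v)) \<le>
          poincare_const \<mu> \<rho> \<Omega> * ennreal (v \<bullet> ((LINT x:\<Omega>|\<mu>. outer (f' x) (f' x)) *v v)))"

text \<open>
  Optimality is witnessed by a function attaining equality. Constants attain \<open>0 = 0\<close>, so
  \<open>matrix_variance \<mu> \<Omega> f\<^sub>0 \<noteq> 0\<close> is required. The extremals are affine functions of the cumulative
  distribution function, so their unweighted energy is proportional to \<open>\<integral> \<rho>\<^sup>2 d\<mu>\<close>, which
  can be infinite; it is required to be finite exactly when it can be, while the energy with the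
  weight in question is always required to be finite.
\<close>

definition weighted_poincare_attained ::
    "real measure \<Rightarrow> (real \<Rightarrow> real) \<Rightarrow> real set \<Rightarrow> (real \<Rightarrow> real ^ 'n) \<Rightarrow> (real \<Rightarrow> real ^ 'n) \<Rightarrow> bool" where
  "weighted_poincare_attained \<mu> \<rho> \<Omega> f\<^sub>0 f\<^sub>0' \<longleftrightarrow>
     f\<^sub>0 \<in> borel_measurable borel \<and> f\<^sub>0' \<in> borel_measurable borel \<and>
     (\<forall>x\<in>\<Omega>. (f\<^sub>0 has_vector_derivative f\<^sub>0' x) (at x)) \<and>
     set_integrable \<mu> \<Omega> (\<lambda>x. (norm (f\<^sub>0 x))\<^sup>2) \<and>
     (set_integrable \<mu> \<Omega> (\<lambda>x. (\<rho> x)\<^sup>2) \<longrightarrow> set_integrable \<mu> \<Omega> (\<lambda>x. (norm (f\<^sub>0' x))\<^sup>2)) \<and>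
     set_integrable \<mu> \<Omega> (\<lambda>x. weight \<mu> \<rho> x *\<^sub>R outer (f\<^sub>0' x) (f\<^sub>0' x)) \<and>
     matrix_variance \<mu> \<Omega> f\<^sub>0 \<noteq> 0 \<and>
     matrix_variance \<mu> \<Omega> f\<^sub>0 =
       (1/2) *\<^sub>R (LINT x:\<Omega>|\<mu>. weight \<mu> \<rho> x *\<^sub>R outer (f\<^sub>0' x) (f\<^sub>0' x))"

end

theory Submission
  imports Defs
begin

text \<open>
  Fix a direction \<open>v\<close> and put \<open>g = v \<bullet> f\<close>; both inequalities then concern the scalar function \<open>g\<close>.
  Twice the variance of \<open>g\<close> is the double integral of \<open>(g(y) - g(x))\<^sup>2\<close>. Let \<open>w\<close> be an increasing
  function on the unit interval and \<open>W = w \<circ> F\<close>. Cauchy--Schwarz gives, for \<open>x < y\<close>,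
  \<open>(g(y) - g(x))\<^sup>2 \<le> (W(y) - W(x)) \<integral> g'(t)\<^sup>2 / W'(t) dt\<close> with \<open>t\<close> ranging from \<open>x\<close> to \<open>y\<close>
  (\<open>increment_square_le\<close>). By Tonelli the variance is at most the integral of \<open>g'(t)\<^sup>2 G(t) / W'(t)\<close>,
  where \<open>G(t)\<close> is the integral of \<open>W(y) - W(x)\<close> over \<open>x < t < y\<close>. As \<open>F\<close> is uniformly
  distributed under \<open>\<mu>\<close> (\<open>distr_F\<close>), \<open>G(t) = \<phi>(F(t))\<close>, where \<open>\<phi>' = -w\<close> and \<open>\<phi>\<close> vanishes
  at both ends of the unit interval (\<open>nn_integral_straddle_kernel\<close>). This proves
  \<open>variance_le_weighted_energy\<close>: the variance of \<open>g\<close> is at most the \<open>\<mu>\<close>-integral of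
  \<open>g'\<^sup>2 \<phi>(F) / (w'(F) \<rho>\<^sup>2)\<close>.

  Two choices of \<open>w\<close> give the two constants. For \<open>w(u) = u - 1/2\<close> one has \<open>\<phi> / w' = u (1 - u) / 2\<close>,
  which is the weighted inequality, and the first term of the minimum once the weight is replaced by
  its supremum. For \<open>\<phi>(u) = sqrt (u (1 - u))\<close> one has \<open>\<phi> / w' = 4 u\<^sup>2 (1 - u)\<^sup>2\<close>, which is the second
  term. In the first case Cauchy--Schwarz is an equality for \<open>g = F\<close>, which therefore attains the
  constant \<open>1/2\<close> (\<open>cdf_attains_weighted_poincare\<close>).
\<close>

section \<open>Cauchy--Schwarz for increments\<close>

lemma ennreal_add_le: "ennreal (a + b) \<le> ennreal a + ennreal b"
proof -
  have "ennreal (a + b) \<le> ennreal (max 0 a + max 0 b)"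
    by (rule ennreal_leI) linarith
  also have "\<dots> = ennreal a + ennreal b"
    by (simp add: ennreal_plus max_def ennreal_neg)
  finally show ?thesis .
qed

text \<open>
  Cauchy--Schwarz for \<open>g(y) - g(x) = \<integral> g'\<close> with weight \<open>W'\<close>, obtained by integrating
  \<open>0 \<le> (g' - c W')\<^sup>2 / W'\<close> for the optimal constant \<open>c\<close>. In this form the only integral of \<open>g'\<close>
  that occurs is a Henstock--Kurzweil one, so the fundamental theorem of calculus applies to
  a derivative that is neither continuous nor Lebesgue integrable.
\<close>

lemma increment_square_le:
  fixes g g' W W' :: "real \<Rightarrow> real"
  assumes "x < y"
    and g: "\<And>t. t \<in> {x..y} \<Longrightarrow> (g has_real_derivative g' t) (at t)"
    and W: "\<And>t. t \<in> {x..y} \<Longrightarrow> (W has_real_derivative W' t) (at t)"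
    and W'_pos: "\<And>t. t \<in> {x..y} \<Longrightarrow> 0 < W' t"
    and [measurable]: "g' \<in> borel_measurable borel" "W' \<in> borel_measurable borel"
  shows "ennreal ((g y - g x)\<^sup>2) \<le>
         ennreal (W y - W x) * (\<integral>\<^sup>+t. ennreal ((g' t)\<^sup>2 / W' t) * indicator {x..y} t \<partial>lborel)"
proof -
  have W_less: "W x < W y"
    using assms(1) W W'_pos by (intro DERIV_pos_imp_increasing[of x y W]) force+
  define q where "q t = (g' t)\<^sup>2 / W' t * indicator {x..y} t" for t
  have q_meas [measurable]: "q \<in> borel_measurable borel"
    unfolding q_def by measurable
  have q_nonneg: "0 \<le> q t" for t
    using W'_pos[of t] by (auto simp: q_def split: split_indicator intro: divide_nonneg_nonneg)
  have q_eq: "(\<integral>\<^sup>+t. ennreal ((g' t)\<^sup>2 / W' t) * indicator {x..y} t \<partial>lborel)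
      = (\<integral>\<^sup>+t. ennreal (q t) \<partial>lborel)"
    by (intro nn_integral_cong) (auto simp: q_def split: split_indicator)
  show ?thesis
  proof (cases "(\<integral>\<^sup>+t. ennreal (q t) \<partial>lborel) = \<infinity>")
    case True
    then show ?thesis
      using W_less unfolding q_eq by (simp add: ennreal_mult_top)
  next
    case False
    then have int: "integrable lborel q"
      by (intro integrableI_nonneg) (auto simp: q_nonneg less_top)
    have q_int: "(q has_integral integral\<^sup>L lborel q) {x..y}"
    proof -
      have "((\<lambda>t. if t \<in> {x..y} then q t else 0) has_integral integral\<^sup>L lborel q) UNIV"
        using has_integral_integral_lborel[OF int]
        by (rule has_integral_eq[rotated]) (auto simp: q_def)
      then show ?thesis
        by (simp only: has_integral_restrict_UNIV)
    qed
    \<comment> \<open>the minimiser over \<open>c\<close> of the integral of \<open>(g' - c W')\<^sup>2 / W'\<close>\<close>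
    define c where "c = (g y - g x) / (W y - W x)"
    have "((\<lambda>t. 2 * c * g' t - c\<^sup>2 * W' t) has_integral
        (2 * c * g y - c\<^sup>2 * W y) - (2 * c * g x - c\<^sup>2 * W x)) {x..y}"
    proof (rule fundamental_theorem_of_calculus)
      show "x \<le> y" using assms(1) by simp
      fix t assume t: "t \<in> {x..y}"
      have "((\<lambda>t. 2 * c * g t - c\<^sup>2 * W t) has_real_derivative 2 * c * g' t - c\<^sup>2 * W' t) (at t)"
        using g[OF t] W[OF t] by (auto intro!: derivative_eq_intros)
      then show "((\<lambda>t. 2 * c * g t - c\<^sup>2 * W t) has_vector_derivative 2 * c * g' t - c\<^sup>2 * W' t)
          (at t within {x..y})"
        by (simp add: has_real_derivative_iff_has_vector_derivative has_vector_derivative_at_within)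
    qed
    moreover have "2 * c * g' t - c\<^sup>2 * W' t \<le> q t" if t: "t \<in> {x..y}" for t
    proof -
      have "0 \<le> (g' t - c * W' t)\<^sup>2 / W' t"
        using W'_pos[OF t] by simp
      also have "\<dots> = q t - (2 * c * g' t - c\<^sup>2 * W' t)"
        using W'_pos[OF t] t by (simp add: q_def field_simps power2_eq_square)
      finally show ?thesis by simp
    qed
    ultimately have "(2 * c * g y - c\<^sup>2 * W y) - (2 * c * g x - c\<^sup>2 * W x) \<le> integral\<^sup>L lborel q"
      by (intro has_integral_le[OF _ q_int]) auto
    moreover have "(2 * c * g y - c\<^sup>2 * W y) - (2 * c * g x - c\<^sup>2 * W x) = (g y - g x)\<^sup>2 / (W y - W x)"
    proof -
      have "(2 * c * g y - c\<^sup>2 * W y) - (2 * c * g x - c\<^sup>2 * W x)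
          = 2 * c * (g y - g x) - c * (c * (W y - W x))"
        by (simp add: algebra_simps power2_eq_square)
      also have "c * (W y - W x) = g y - g x"
        using W_less by (simp add: c_def)
      finally show ?thesis
        by (simp add: c_def power2_eq_square)
    qed
    ultimately have "(g y - g x)\<^sup>2 / (W y - W x) \<le> integral\<^sup>L lborel q"
      by linarith
    then have "(g y - g x)\<^sup>2 \<le> (W y - W x) * integral\<^sup>L lborel q"
      using W_less by (simp only: pos_divide_le_eq diff_gt_0_iff_gt mult.commute[of "W y - W x"])
    then have "ennreal ((g y - g x)\<^sup>2) \<le> ennreal (W y - W x) * ennreal (integral\<^sup>L lborel q)"
      using W_less by (subst ennreal_mult[symmetric]) (auto intro!: ennreal_leI Bochner_Integration.integral_nonneg q_nonneg)
    also have "ennreal (integral\<^sup>L lborel q) = (\<integral>\<^sup>+t. ennreal (q t) \<partial>lborel)"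
      using int q_nonneg by (intro nn_integral_eq_integral[symmetric]) auto
    finally show ?thesis unfolding q_eq .
  qed
qed

section \<open>Comparison functions on the unit interval\<close>

text \<open>
  The comparison functions below may have an infinite slope, or be unbounded, at the ends of the
  unit interval. Hence the antiderivative is differentiable only inside the interval, and the
  integral is an improper one.
\<close>

lemma nn_integral_FTC_open:
  fixes f G :: "real \<Rightarrow> real"
  assumes "a < b" and G: "continuous_on {a..b} G"
    and deriv: "\<And>x. a < x \<Longrightarrow> x < b \<Longrightarrow> (G has_real_derivative f x) (at x)"
    and cont: "\<And>x. a < x \<Longrightarrow> x < b \<Longrightarrow> isCont f x"
    and nonneg: "\<And>x. a < x \<Longrightarrow> x < b \<Longrightarrow> 0 \<le> f x"
  shows "(\<integral>\<^sup>+x. ennreal (f x) * indicator {a<..<b} x \<partial>lborel) = ennreal (G b - G a) \<and> 0 \<le> G b - G a"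
proof -
  have "(G \<longlongrightarrow> G a) (at_right a)" "(G \<longlongrightarrow> G b) (at_left b)"
    using continuous_on_Icc_at_rightD[OF G \<open>a < b\<close>] continuous_on_Icc_at_leftD[OF G \<open>a < b\<close>] .
  then have lim: "((G \<circ> real_of_ereal) \<longlongrightarrow> G a) (at_right (ereal a))"
      "((G \<circ> real_of_ereal) \<longlongrightarrow> G b) (at_left (ereal b))"
    by (simp_all add: ereal_tendsto_simps)
  have int: "set_integrable lborel (einterval (ereal a) (ereal b)) f"
    using assms by (intro interval_integral_FTC_nonneg(1)[where F = G, OF _ _ _ _ lim]) auto
  have eq: "(LBINT x=ereal a..ereal b. f x) = G b - G a"
    using assms by (intro interval_integral_FTC_nonneg(2)[where F = G, OF _ _ _ _ lim]) auto
  have int': "integrable lborel (\<lambda>x. indicator {a<..<b} x * f x)"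
    using int by (simp add: set_integrable_def)
  have eq': "(\<integral>x. indicator {a<..<b} x * f x \<partial>lborel) = G b - G a"
    using eq \<open>a < b\<close> by (simp add: interval_lebesgue_integral_def set_lebesgue_integral_def)
  have nn: "0 \<le> indicator {a<..<b} x * f x" for x
    using nonneg by (auto split: split_indicator)
  have "(\<integral>\<^sup>+x. ennreal (f x) * indicator {a<..<b} x \<partial>lborel)
      = (\<integral>\<^sup>+x. ennreal (indicator {a<..<b} x * f x) \<partial>lborel)"
    by (intro nn_integral_cong) (auto split: split_indicator)
  also have "\<dots> = ennreal (G b - G a)"
    using nn_integral_eq_integral[OF int'] nn eq' by simp
  finally show ?thesis
    using eq' Bochner_Integration.integral_nonneg[of lborel "\<lambda>x. indicator {a<..<b} x * f x"] nn by simp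
qed

text \<open>
  A comparison function \<open>w\<close> on the unit interval, given with its derivative \<open>w'\<close> and with \<open>\<phi>\<close>, the
  antiderivative of \<open>-w\<close> vanishing at both ends (so that \<open>w\<close> has mean zero). The resulting
  Poincare inequality for the uniform distribution has the weight \<open>\<phi> / w'\<close>.
\<close>

locale potential =
  fixes w w' \<phi> :: "real \<Rightarrow> real"
  assumes w_deriv: "\<And>u. 0 < u \<Longrightarrow> u < 1 \<Longrightarrow> (w has_real_derivative w' u) (at u)"
    and w'_pos: "\<And>u. 0 < u \<Longrightarrow> u < 1 \<Longrightarrow> 0 < w' u"
    and w_borel [measurable]: "w \<in> borel_measurable borel"
    and w'_borel [measurable]: "w' \<in> borel_measurable borel"
    and \<phi>_borel [measurable]: "\<phi> \<in> borel_measurable borel"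
    and \<phi>_deriv: "\<And>u. 0 < u \<Longrightarrow> u < 1 \<Longrightarrow> (\<phi> has_real_derivative - w u) (at u)"
    and \<phi>_cont: "continuous_on {0..1} \<phi>"
    and \<phi>_0: "\<phi> 0 = 0" and \<phi>_1: "\<phi> 1 = 0"
begin

lemma w_mono: "0 < u \<Longrightarrow> u \<le> v \<Longrightarrow> v < 1 \<Longrightarrow> w u \<le> w v"
proof -
  assume a: "0 < u" "u \<le> v" "v < 1"
  show "w u \<le> w v"
  proof (rule DERIV_nonneg_imp_nondecreasing[OF a(2)])
    fix x assume "u \<le> x" "x \<le> v"
    then show "\<exists>y. DERIV w x :> y \<and> 0 \<le> y"
      using a w_deriv[of x] w'_pos[of x] by force
  qed
qed

lemma w_isCont: "0 < u \<Longrightarrow> u < 1 \<Longrightarrow> isCont w u"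
  using w_deriv DERIV_isCont by blast

text \<open>
  Monotonicity of \<open>w\<close> confines the positive part of \<open>w - w(s)\<close> to the right of \<open>s\<close>, and the negative
  part to the left. The values are recorded to be non-negative because \<open>ennreal\<close> truncates.
\<close>

lemma nn_integral_above:
  assumes s: "0 < s" "s < 1"
  shows "(\<integral>\<^sup>+u. ennreal (w u - w s) * indicator {0..1} u \<partial>lborel) = ennreal (\<phi> s - (1 - s) * w s)"
    and "0 \<le> \<phi> s - (1 - s) * w s"
proof -
  have "AE u in lborel. u \<noteq> 0 \<and> u \<noteq> (1::real)"
    using AE_lborel_singleton[of 0] AE_lborel_singleton[of "1::real"] by auto
  then have "(\<integral>\<^sup>+u. ennreal (w u - w s) * indicator {0..1} u \<partial>lborel)
      = (\<integral>\<^sup>+u. ennreal (w u - w s) * indicator {s<..<1} u \<partial>lborel)"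
    using s w_mono
    by (intro nn_integral_cong_AE, elim AE_mp)
       (auto split: split_indicator simp: ennreal_eq_0_iff)
  moreover have "(\<integral>\<^sup>+u. ennreal (w u - w s) * indicator {s<..<1} u \<partial>lborel)
      = ennreal ((- \<phi> 1 - w s * 1) - (- \<phi> s - w s * s)) \<and>
      0 \<le> (- \<phi> 1 - w s * 1) - (- \<phi> s - w s * s)"
  proof (rule nn_integral_FTC_open)
    show "continuous_on {s..1} (\<lambda>u. - \<phi> u - w s * u)"
      using s by (intro continuous_intros continuous_on_subset[OF \<phi>_cont]) auto
  qed (use s in \<open>auto intro!: derivative_eq_intros \<phi>_deriv w_mono w_isCont continuous_intros\<close>)
  ultimately show "(\<integral>\<^sup>+u. ennreal (w u - w s) * indicator {0..1} u \<partial>lborel) = ennreal (\<phi> s - (1 - s) * w s)"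
    and "0 \<le> \<phi> s - (1 - s) * w s"
    by (simp_all add: \<phi>_1 algebra_simps)
qed

lemma nn_integral_below:
  assumes s: "0 < s" "s < 1"
  shows "(\<integral>\<^sup>+u. ennreal (w s - w u) * indicator {0..1} u \<partial>lborel) = ennreal (\<phi> s + s * w s)"
    and "0 \<le> \<phi> s + s * w s"
proof -
  have "AE u in lborel. u \<noteq> 0 \<and> u \<noteq> (1::real)"
    using AE_lborel_singleton[of 0] AE_lborel_singleton[of "1::real"] by auto
  then have "(\<integral>\<^sup>+u. ennreal (w s - w u) * indicator {0..1} u \<partial>lborel)
      = (\<integral>\<^sup>+u. ennreal (w s - w u) * indicator {0<..<s} u \<partial>lborel)"
    using s w_mono
    by (intro nn_integral_cong_AE, elim AE_mp)
       (auto split: split_indicator simp: ennreal_eq_0_iff)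
  moreover have "(\<integral>\<^sup>+u. ennreal (w s - w u) * indicator {0<..<s} u \<partial>lborel)
      = ennreal ((w s * s + \<phi> s) - (w s * 0 + \<phi> 0)) \<and>
      0 \<le> (w s * s + \<phi> s) - (w s * 0 + \<phi> 0)"
  proof (rule nn_integral_FTC_open)
    show "continuous_on {0..s} (\<lambda>u. w s * u + \<phi> u)"
      using s by (intro continuous_intros continuous_on_subset[OF \<phi>_cont]) auto
  qed (use s in \<open>auto intro!: derivative_eq_intros \<phi>_deriv w_mono w_isCont continuous_intros\<close>)
  ultimately show "(\<integral>\<^sup>+u. ennreal (w s - w u) * indicator {0..1} u \<partial>lborel) = ennreal (\<phi> s + s * w s)"
    and "0 \<le> \<phi> s + s * w s"
    by (simp_all add: \<phi>_0 algebra_simps)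
qed

end

section \<open>Positive continuous densities on an open interval\<close>

locale interval_density = real_distribution \<mu> for \<mu> :: "real measure" +
  fixes \<rho> :: "real \<Rightarrow> real" and \<Omega> :: "real set"
  assumes \<mu>_eq: "\<mu> = density lborel (\<lambda>x. ennreal (\<rho> x))"
    and open_\<Omega>: "open \<Omega>" and connected_\<Omega>: "connected \<Omega>"
    and \<rho>_cont: "continuous_on \<Omega> \<rho>"
    and \<rho>_pos: "\<And>x. x \<in> \<Omega> \<Longrightarrow> 0 < \<rho> x" and \<rho>_zero: "\<And>x. x \<notin> \<Omega> \<Longrightarrow> \<rho> x = 0"
begin

abbreviation "F \<equiv> cdf \<mu>"

lemma \<Omega>_borel [measurable]: "\<Omega> \<in> sets borel"
  using open_\<Omega> by simp

lemma \<rho>_nonneg: "0 \<le> \<rho> x"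
  using \<rho>_pos[of x] \<rho>_zero[of x] by (cases "x \<in> \<Omega>") auto

lemma \<rho>_borel [measurable]: "\<rho> \<in> borel_measurable borel"
proof -
  have "(\<lambda>x. if x \<in> \<Omega> then \<rho> x else 0) \<in> borel_measurable borel"
    by (intro borel_measurable_continuous_on_if \<rho>_cont) auto
  moreover have "(\<lambda>x. if x \<in> \<Omega> then \<rho> x else 0) = \<rho>"
    using \<rho>_zero by auto
  ultimately show ?thesis by simp
qed

lemma F_borel [measurable]: "F \<in> borel_measurable borel"
  by (intro borel_measurable_mono monoI cdf_nondecreasing)

lemma AE_in_\<Omega>: "AE x in \<mu>. x \<in> \<Omega>"
proof (subst \<mu>_eq, subst AE_density)
  show "AE x in lborel. 0 < ennreal (\<rho> x) \<longrightarrow> x \<in> \<Omega>"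
    using \<rho>_zero by (intro AE_I2) (metis ennreal_0 less_irrefl)
qed auto

lemma nn_integral_\<mu>:
  "h \<in> borel_measurable borel \<Longrightarrow> (\<integral>\<^sup>+x. h x \<partial>\<mu>) = (\<integral>\<^sup>+x. ennreal (\<rho> x) * h x \<partial>lborel)"
  by (subst \<mu>_eq, subst nn_integral_density) auto

lemma no_atoms: "measure \<mu> {x} = 0"
proof -
  have "emeasure \<mu> {x} = (\<integral>\<^sup>+y. ennreal (\<rho> y) * indicator {x} y \<partial>lborel)"
    by (subst \<mu>_eq, subst emeasure_density) auto
  also have "\<dots> = (\<integral>\<^sup>+y. 0 \<partial>(lborel :: real measure))"
    using AE_lborel_singleton[of x]
    by (intro nn_integral_cong_AE, elim AE_mp) (auto split: split_indicator)
  finally show ?thesis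
    by (simp add: measure_def)
qed

lemma F_cont: "isCont F x"
  using isCont_cdf no_atoms by blast

lemma Icc_subset_\<Omega>: "x \<in> \<Omega> \<Longrightarrow> y \<in> \<Omega> \<Longrightarrow> {x..y} \<subseteq> \<Omega>"
  by (rule connected_contains_Icc[OF connected_\<Omega>])

lemma F_deriv:
  assumes "x \<in> \<Omega>"
  shows "(F has_real_derivative \<rho> x) (at x)"
proof -
  obtain e where e: "0 < e" "cball x e \<subseteq> \<Omega>"
    using open_\<Omega>[unfolded open_contains_cball, THEN bspec, OF assms] by auto
  define a b where "a = x - e" and "b = x + e"
  have ab: "{a..b} \<subseteq> \<Omega>" "a < x" "x < b"
    using e by (auto simp: a_def b_def cball_eq_atLeastAtMost)
  have cont: "continuous_on {a..b} \<rho>"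
    using \<rho>_cont ab continuous_on_subset by blast
  have F_eq: "F y = F a + integral {a..y} \<rho>" if y: "y \<in> {a..b}" for y
  proof -
    have "((\<lambda>t. if t \<in> {a..y} then \<rho> t else 0) has_integral integral {a..y} \<rho>) UNIV"
      unfolding has_integral_restrict_UNIV using y
      by (intro integrable_integral integrable_continuous_interval continuous_on_subset[OF cont]) auto
    then have "(\<integral>\<^sup>+t. ennreal (if t \<in> {a..y} then \<rho> t else 0) \<partial>lborel) = ennreal (integral {a..y} \<rho>)"
      by (intro nn_integral_has_integral_lborel) (auto simp: \<rho>_nonneg)
    also have "(\<integral>\<^sup>+t. ennreal (if t \<in> {a..y} then \<rho> t else 0) \<partial>lborel)
        = (\<integral>\<^sup>+t. ennreal (\<rho> t) * indicator {a<..y} t \<partial>lborel)"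
      using AE_lborel_singleton[of a]
      by (intro nn_integral_cong_AE, elim AE_mp) (auto split: split_indicator)
    also have "\<dots> = emeasure \<mu> {a<..y}"
      by (subst \<mu>_eq, subst emeasure_density) auto
    also have "\<dots> = ennreal (F y - F a)"
      using y by (intro emeasure_Ioc) auto
    finally show ?thesis
      using y by (subst (asm) ennreal_inj)
        (auto intro!: cdf_nondecreasing Henstock_Kurzweil_Integration.integral_nonneg
            integrable_continuous_interval continuous_on_subset[OF cont] \<rho>_nonneg)
  qed
  have "((\<lambda>y. F a + integral {a..y} \<rho>) has_real_derivative \<rho> x) (at x within {a..b})"
    using integral_has_real_derivative[OF cont, of x] ab by (auto intro!: derivative_eq_intros)
  then have "(F has_real_derivative \<rho> x) (at x within {a..b})"
  proof (rule has_field_derivative_transform_within[where d = 1])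
    show "F a + integral {a..y} \<rho> = F y" if "y \<in> {a..b}" for y
      using F_eq[OF that] by (rule sym)
  qed (use ab in auto)
  moreover have "x \<in> interior {a..b}"
    using ab by (simp add: interior_atLeastAtMost_real)
  ultimately show ?thesis
    by (simp only: at_within_interior)
qed

lemma F_less:
  assumes "x \<in> \<Omega>" "y \<in> \<Omega>" "x < y"
  shows "F x < F y"
proof (rule DERIV_pos_imp_increasing[OF assms(3)])
  fix t assume "x \<le> t" "t \<le> y"
  then have "t \<in> \<Omega>"
    using Icc_subset_\<Omega>[OF assms(1,2)] by auto
  then show "\<exists>D. DERIV F t :> D \<and> 0 < D"
    by (intro exI[of _ "\<rho> t"] conjI F_deriv \<rho>_pos)
qed

lemma F_bounds:
  assumes "x \<in> \<Omega>"
  shows "0 < F x" "F x < 1"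
proof -
  obtain e where e: "0 < e" "cball x e \<subseteq> \<Omega>"
    using open_\<Omega>[unfolded open_contains_cball, THEN bspec, OF assms] by auto
  then have "x - e \<in> \<Omega>" "x + e \<in> \<Omega>"
    by (auto simp: cball_eq_atLeastAtMost subset_iff)
  then have "F (x - e) < F x" "F x < F (x + e)"
    using e assms by (auto intro!: F_less)
  then show "0 < F x" "F x < 1"
    using cdf_nonneg[of "x - e"] cdf_bounded_prob[of "x + e"] by auto
qed

subsection \<open>The distribution function as a uniform random variable\<close>

lemma F_onto:
  assumes "0 < u" "u < 1"
  shows "\<exists>x. F x = u"
proof -
  have "\<forall>\<^sub>F x in at_bot. F x < u"
    by (rule order_tendstoD(2)[OF cdf_lim_at_bot assms(1)])
  then obtain a where a: "F a < u"
    by (auto simp: eventually_at_bot_linorder)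
  have "\<forall>\<^sub>F x in at_top. u < F x"
    by (rule order_tendstoD(1)[OF cdf_lim_at_top_prob assms(2)])
  then obtain b where b: "u < F b"
    by (auto simp: eventually_at_top_linorder)
  have "a \<le> b"
    using a b cdf_nondecreasing[of b a] by linarith
  then show ?thesis
    using IVT[of F a u b] a b F_cont by auto
qed

text \<open>
  If \<open>F y = v\<close>, the sets \<open>{x. F x \<le> u}\<close> and \<open>{..y}\<close> are nested, by monotonicity of \<open>F\<close>; the value
  \<open>v = u\<close> gives the lower bound, and the values \<open>v > u\<close> give the upper bound.
\<close>

lemma prob_F_le:
  assumes "0 \<le> u" "u < 1"
  shows "measure \<mu> {x. F x \<le> u} = u"
proof (rule antisym)
  show "measure \<mu> {x. F x \<le> u} \<le> u"
  proof (rule dense_ge_bounded[OF assms(2)])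
    fix v assume v: "u < v" "v < 1"
    then obtain y where y: "F y = v"
      using F_onto[of v] assms by auto
    have "x \<le> y" if "F x \<le> u" for x
      using that y v cdf_nondecreasing[of y x] by linarith
    then have "measure \<mu> {x. F x \<le> u} \<le> measure \<mu> {..y}"
      by (intro finite_measure_mono) auto
    then show "measure \<mu> {x. F x \<le> u} \<le> v"
      using y by (simp add: cdf_def)
  qed
  show "u \<le> measure \<mu> {x. F x \<le> u}"
  proof (cases "u = 0")
    case False
    then obtain y where y: "F y = u"
      using F_onto[of u] assms by auto
    have "measure \<mu> {..y} \<le> measure \<mu> {x. F x \<le> u}"
      using cdf_nondecreasing[of _ y] unfolding y by (intro finite_measure_mono) auto
    then show ?thesis
      using y by (simp add: cdf_def)
  qed simp
qed

lemma distr_F: "distr \<mu> borel F = density lborel (indicator {0..1})"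
proof (rule cdf_unique)
  have "prob_space (density lborel (indicator {0..1::real}))"
    by (intro prob_spaceI) (simp add: emeasure_density)
  then show uni: "real_distribution (density lborel (indicator {0..1}))"
    by (simp add: real_distribution_def real_distribution_axioms_def)
  show "real_distribution (distr \<mu> borel F)" by simp
  show "cdf (distr \<mu> borel F) = cdf (density lborel (indicator {0..1}))"
  proof
    fix u :: real
    have L: "cdf (distr \<mu> borel F) u = measure \<mu> {x. F x \<le> u}"
      unfolding cdf_def[of "distr \<mu> borel F"] by (subst measure_distr) (auto simp: vimage_def)
    have R: "cdf (density lborel (indicator {0..1})) u = measure lborel ({0..1} \<inter> {..u})"
      unfolding cdf_def measure_def
      by (subst emeasure_density) (auto simp: indicator_inter_arith[symmetric])
    consider "u < 0" | "0 \<le> u" "u < 1" | "1 \<le> u" by linarith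
    then show "cdf (distr \<mu> borel F) u = cdf (density lborel (indicator {0..1})) u"
    proof cases
      case 1
      then have "{x. F x \<le> u} = {}" "{0..1} \<inter> {..u} = {}"
        using cdf_nonneg by (auto simp: not_le intro: less_le_trans)
      then show ?thesis unfolding L R by simp
    next
      case 2
      then have "{0..1} \<inter> {..u} = {0..u}" by auto
      then show ?thesis using prob_F_le 2 unfolding L R by simp
    next
      case 3
      then have "{x. F x \<le> u} = UNIV" "{0..1} \<inter> {..u} = {0..1}"
        using cdf_bounded_prob by (auto intro: order_trans)
      then show ?thesis using prob_space unfolding L R by simp
    qed
  qed
qed

lemma nn_integral_comp_F:
  assumes [measurable]: "h \<in> borel_measurable borel"
  shows "(\<integral>\<^sup>+x. h (F x) \<partial>\<mu>) = (\<integral>\<^sup>+u. h u * indicator {0..1} u \<partial>lborel)"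
proof -
  have "(\<integral>\<^sup>+x. h (F x) \<partial>\<mu>) = (\<integral>\<^sup>+u. h u \<partial>distr \<mu> borel F)"
    by (subst nn_integral_distr) auto
  also have "\<dots> = (\<integral>\<^sup>+u. h u * indicator {0..1} u \<partial>lborel)"
    unfolding distr_F by (subst nn_integral_density) (auto simp: mult.commute)
  finally show ?thesis .
qed

text \<open>Used for the moments of \<open>F\<close>, which decide the case of equality.\<close>

lemma integral_comp_F:
  fixes h G :: "real \<Rightarrow> real"
  assumes G: "\<And>u. (G has_real_derivative h u) (at u)" and h: "continuous_on UNIV h"
  shows "integrable \<mu> (\<lambda>x. h (F x))" "(\<integral>x. h (F x) \<partial>\<mu>) = G 1 - G 0"
proof -
  have [measurable]: "h \<in> borel_measurable borel"
    using h by (rule borel_measurable_continuous_onI)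
  have hb: "has_bochner_integral lborel (\<lambda>u. h u * indicator {0..1} u) (G 1 - G 0)"
    using G h by (intro has_bochner_integral_FTC_Icc_real)
      (auto simp: continuous_on_eq_continuous_at)
  then have hb': "has_bochner_integral lborel (\<lambda>u. indicator {0..1} u *\<^sub>R h u) (G 1 - G 0)"
    by (simp add: mult.commute)
  have "has_bochner_integral (density lborel (\<lambda>u. ennreal (indicator {0..1} u))) h (G 1 - G 0)"
    using hb' by (intro has_bochner_integral_density) auto
  then have "has_bochner_integral (density lborel (indicator {0..1})) h (G 1 - G 0)"
    by (simp only: ennreal_indicator)
  then have "has_bochner_integral (distr \<mu> borel F) h (G 1 - G 0)"
    unfolding distr_F .
  then show "integrable \<mu> (\<lambda>x. h (F x))" "(\<integral>x. h (F x) \<partial>\<mu>) = G 1 - G 0"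
    by (auto simp: has_bochner_integral_iff integrable_distr_eq integral_distr)
qed

end

section \<open>The variance inequality with a general weight\<close>

text \<open>
  When \<open>t\<close> lies between \<open>x\<close> and \<open>y\<close>, the increment \<open>\<bar>W(y) - W(x)\<bar>\<close> splits at \<open>t\<close>. The kernel
  is a majorant of it: a sum of products in which \<open>x\<close> and \<open>y\<close> are separated, so that its double
  integral reduces to single ones. The conversion to \<open>ennreal\<close> serves as the positive part.
\<close>

definition straddle_kernel :: "(real \<Rightarrow> real) \<Rightarrow> real \<Rightarrow> real \<Rightarrow> real \<Rightarrow> ennreal" where
  "straddle_kernel W t x y =
     ennreal (W y - W t) * indicator {..t} x + ennreal (W t - W x) * indicator {t..} y +
     (ennreal (W x - W t) * indicator {..t} y + ennreal (W t - W y) * indicator {t..} x)"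

lemma straddle_kernel_commute: "straddle_kernel W t x y = straddle_kernel W t y x"
  by (simp add: straddle_kernel_def ac_simps)

lemma straddle_kernel_ge:
  assumes "x \<le> t" "t \<le> y"
  shows "ennreal (W y - W x) \<le> straddle_kernel W t x y"
proof -
  have "ennreal (W y - W x) \<le> ennreal (W y - W t) + ennreal (W t - W x)"
    using ennreal_add_le[of "W y - W t" "W t - W x"] by simp
  also have "\<dots> \<le> straddle_kernel W t x y"
    using assms by (simp add: straddle_kernel_def)
  finally show ?thesis .
qed

lemma borel_measurable_straddle_kernel [measurable (raw)]:
  assumes [measurable]: "W \<in> borel_measurable borel"
    and [measurable]: "a \<in> borel_measurable M" "b \<in> borel_measurable M" "c \<in> borel_measurable M"
  shows "(\<lambda>z. straddle_kernel W (a z) (b z) (c z)) \<in> borel_measurable M"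
proof -
  have indicator_eq: "indicator {..t} x = (if x \<le> t then 1 else (0::ennreal))"
    "indicator {t..} x = (if t \<le> x then 1 else (0::ennreal))" for t x :: real
    by simp_all
  then show ?thesis
    unfolding straddle_kernel_def indicator_eq by measurable
qed

context interval_density
begin

lemma emeasure_atLeast: "emeasure \<mu> {t..} = ennreal (1 - F t)"
proof -
  have "measure \<mu> {t..} = measure \<mu> ({t} \<union> {t<..})"
    by (rule arg_cong[where f = "measure \<mu>"]) auto
  also have "\<dots> = measure \<mu> {t<..}"
    using no_atoms[of t] by (subst finite_measure_Union) auto
  also have "{t<..} = space \<mu> - {..t}" by auto
  also have "measure \<mu> \<dots> = 1 - F t"
    by (subst prob_compl) (auto simp: cdf_def)
  finally show ?thesis by (simp add: emeasure_eq_measure)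
qed

text \<open>
  With \<open>s = F(t)\<close>, half of the double integral is \<open>s A + (1 - s) B\<close>, where \<open>A\<close> and \<open>B\<close> are the
  integrals of the positive and the negative part of \<open>w - w(s)\<close>. The two
  terms in \<open>w(s)\<close> cancel and \<open>\<phi>(s)\<close> remains.
\<close>

lemma nn_integral_straddle_kernel:
  assumes "potential w w' \<phi>" and t: "t \<in> \<Omega>"
  shows "(\<integral>\<^sup>+x. \<integral>\<^sup>+y. straddle_kernel (\<lambda>x. w (F x)) t x y \<partial>\<mu> \<partial>\<mu>) = ennreal (2 * \<phi> (F t))"
proof -
  interpret potential w w' \<phi> by fact
  define s where "s = F t"
  have s: "0 < s" "s < 1" using F_bounds[OF t] by (auto simp: s_def)
  define A where "A = \<phi> s - (1 - s) * w s"
  define B where "B = \<phi> s + s * w s"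
  have nonneg: "0 \<le> A" "0 \<le> B"
    using nn_integral_above(2)[OF s] nn_integral_below(2)[OF s] by (simp_all add: A_def B_def)
  have above: "(\<integral>\<^sup>+y. ennreal (w (F y) - w s) \<partial>\<mu>) = ennreal A"
    unfolding A_def using nn_integral_above(1)[OF s] nn_integral_comp_F[of "\<lambda>u. ennreal (w u - w s)"]
    by simp
  have below: "(\<integral>\<^sup>+y. ennreal (w s - w (F y)) \<partial>\<mu>) = ennreal B"
    unfolding B_def using nn_integral_below(1)[OF s] nn_integral_comp_F[of "\<lambda>u. ennreal (w s - w u)"]
    by simp
  have le: "emeasure \<mu> {..t} = ennreal s"
    by (simp add: s_def cdf_def emeasure_eq_measure)
  have ge: "emeasure \<mu> {t..} = ennreal (1 - s)"
    by (simp add: s_def emeasure_atLeast)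
  have "(\<integral>\<^sup>+y. straddle_kernel (\<lambda>x. w (F x)) t x y \<partial>\<mu>)
      = ennreal A * indicator {..t} x + ennreal (w s - w (F x)) * ennreal (1 - s) +
        (ennreal (w (F x) - w s) * ennreal s + ennreal B * indicator {t..} x)" for x
    unfolding straddle_kernel_def s_def[symmetric]
    by (simp add: nn_integral_add nn_integral_multc nn_integral_cmult above below le ge)
  then have "(\<integral>\<^sup>+x. \<integral>\<^sup>+y. straddle_kernel (\<lambda>x. w (F x)) t x y \<partial>\<mu> \<partial>\<mu>)
      = ennreal A * ennreal s + ennreal B * ennreal (1 - s) +
        (ennreal A * ennreal s + ennreal B * ennreal (1 - s))"
    by (simp add: nn_integral_add nn_integral_multc nn_integral_cmult above below le ge)
  also have "\<dots> = ennreal (A * s + B * (1 - s) + (A * s + B * (1 - s)))"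
    using nonneg s
    by (simp only: ennreal_mult[symmetric] ennreal_plus[symmetric] mult_nonneg_nonneg add_nonneg_nonneg
        diff_ge_0_iff_ge less_imp_le)
  also have "A * s + B * (1 - s) + (A * s + B * (1 - s)) = 2 * \<phi> s"
    by (simp add: A_def B_def algebra_simps)
  finally show ?thesis by (simp add: s_def)
qed

lemma double_variance:
  fixes g :: "real \<Rightarrow> real"
  assumes [measurable]: "g \<in> borel_measurable borel" and g2: "integrable \<mu> (\<lambda>x. (g x)\<^sup>2)"
  shows "(\<integral>\<^sup>+x. \<integral>\<^sup>+y. ennreal ((g y - g x)\<^sup>2) \<partial>\<mu> \<partial>\<mu>)
       = 2 * ennreal ((\<integral>x. (g x)\<^sup>2 \<partial>\<mu>) - (\<integral>x. g x \<partial>\<mu>)\<^sup>2)"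
proof -
  define m where "m = (\<integral>x. g x \<partial>\<mu>)"
  define q where "q = (\<integral>x. (g x)\<^sup>2 \<partial>\<mu>)"
  have g1: "integrable \<mu> g"
    by (rule square_integrable_imp_integrable[OF _ g2]) simp
  have sq: "(g y - c)\<^sup>2 = (g y)\<^sup>2 - 2 * c * g y + c\<^sup>2" for y c
    by (simp add: power2_diff)
  have int1: "integrable \<mu> (\<lambda>y. (g y - c)\<^sup>2)" for c
    unfolding sq using g1 g2 by simp
  have eq1: "(\<integral>y. (g y - c)\<^sup>2 \<partial>\<mu>) = q - 2 * c * m + c\<^sup>2" for c
    unfolding sq using g1 g2 prob_space by (simp add: q_def m_def)
  have inner: "(\<integral>\<^sup>+y. ennreal ((g y - g x)\<^sup>2) \<partial>\<mu>) = ennreal (q - 2 * m * g x + (g x)\<^sup>2)" for x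
    using nn_integral_eq_integral[OF int1[of "g x"]] eq1[of "g x"] by (simp add: mult_ac)
  have nonneg: "0 \<le> q - 2 * m * g x + (g x)\<^sup>2" for x
    using eq1[of "g x"] Bochner_Integration.integral_nonneg[of \<mu> "\<lambda>y. (g y - g x)\<^sup>2"]
    by (simp add: mult_ac)
  have int2: "integrable \<mu> (\<lambda>x. q - 2 * m * g x + (g x)\<^sup>2)"
    using g1 g2 by simp
  have eq2: "(\<integral>x. q - 2 * m * g x + (g x)\<^sup>2 \<partial>\<mu>) = 2 * (q - m\<^sup>2)"
    using g1 g2 prob_space
    by (simp add: q_def[symmetric] m_def[symmetric]) (simp add: power2_eq_square)
  have "(\<integral>\<^sup>+x. \<integral>\<^sup>+y. ennreal ((g y - g x)\<^sup>2) \<partial>\<mu> \<partial>\<mu>) = ennreal (2 * (q - m\<^sup>2))"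
    unfolding inner eq2[symmetric] using int2 nonneg by (intro nn_integral_eq_integral) auto
  also have "\<dots> = 2 * ennreal (q - m\<^sup>2)"
    by (simp only: ennreal_mult' ennreal_numeral zero_le_numeral)
  finally show ?thesis by (simp only: q_def m_def)
qed

text \<open>
  Twice the variance is the double integral of \<open>(g(y) - g(x))\<^sup>2\<close>. Each increment is bounded by
  Cauchy--Schwarz with \<open>W = w \<circ> F\<close>; after an exchange of the integrals, the coefficient of
  \<open>g'(t)\<^sup>2 / W'(t)\<close> is the double integral of the kernel over all pairs \<open>x\<close>, \<open>y\<close>.
\<close>

theorem variance_le_weighted_energy:
  fixes g g' :: "real \<Rightarrow> real"
  assumes pot: "potential w w' \<phi>"
    and [measurable]: "g \<in> borel_measurable borel" "g' \<in> borel_measurable borel"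
    and deriv: "\<And>x. x \<in> \<Omega> \<Longrightarrow> (g has_real_derivative g' x) (at x)"
    and g2: "integrable \<mu> (\<lambda>x. (g x)\<^sup>2)"
  shows "ennreal ((\<integral>x. (g x)\<^sup>2 \<partial>\<mu>) - (\<integral>x. g x \<partial>\<mu>)\<^sup>2)
       \<le> (\<integral>\<^sup>+x\<in>\<Omega>. ennreal (\<phi> (F x) / w' (F x) / (\<rho> x)\<^sup>2 * (g' x)\<^sup>2) \<partial>\<mu>)"
proof -
  interpret potential w w' \<phi> by fact
  interpret L: pair_sigma_finite \<mu> "lborel :: real measure"
    by (rule pair_sigma_finite.intro) (unfold_locales)
  define W where "W x = w (F x)" for x
  define W' where "W' x = w' (F x) * \<rho> x" for x
  have [measurable]: "W \<in> borel_measurable borel" "W' \<in> borel_measurable borel"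
    unfolding W_def W'_def by measurable
  have W_deriv: "(W has_real_derivative W' x) (at x)" if "x \<in> \<Omega>" for x
    unfolding W_def W'_def using that F_bounds w_deriv F_deriv by (intro DERIV_chain2) auto
  have W'_pos: "0 < W' x" if "x \<in> \<Omega>" for x
    unfolding W'_def using that F_bounds w'_pos \<rho>_pos by simp
  define q where "q t = ennreal ((g' t)\<^sup>2 / W' t) * indicator \<Omega> t" for t
  have [measurable]: "q \<in> borel_measurable borel"
    unfolding q_def by measurable
  have half: "ennreal ((g y - g x)\<^sup>2) \<le> (\<integral>\<^sup>+t. straddle_kernel W t x y * q t \<partial>lborel)"
    if "x < y" "x \<in> \<Omega>" "y \<in> \<Omega>" for x y
  proof -
    have sub: "{x..y} \<subseteq> \<Omega>" using that by (intro Icc_subset_\<Omega>)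
    then have "ennreal ((g y - g x)\<^sup>2) \<le>
        ennreal (W y - W x) * (\<integral>\<^sup>+t. ennreal ((g' t)\<^sup>2 / W' t) * indicator {x..y} t \<partial>lborel)"
      using that(1) deriv W_deriv W'_pos by (intro increment_square_le) auto
    also have "\<dots> = (\<integral>\<^sup>+t. ennreal (W y - W x) * (ennreal ((g' t)\<^sup>2 / W' t) * indicator {x..y} t) \<partial>lborel)"
      by (intro nn_integral_cmult[symmetric]) measurable
    also have "\<dots> \<le> (\<integral>\<^sup>+t. straddle_kernel W t x y * q t \<partial>lborel)"
      using sub by (intro nn_integral_mono)
        (auto simp: q_def split: split_indicator intro!: mult_right_mono straddle_kernel_ge)
    finally show ?thesis .
  qed
  have kernel_bound: "ennreal ((g y - g x)\<^sup>2) \<le> (\<integral>\<^sup>+t. straddle_kernel W t x y * q t \<partial>lborel)"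
    if "x \<in> \<Omega>" "y \<in> \<Omega>" for x y
  proof (cases x y rule: linorder_cases)
    case less
    then show ?thesis using half that by simp
  next
    case greater
    have "ennreal ((g y - g x)\<^sup>2) = ennreal ((g x - g y)\<^sup>2)"
      by (simp only: power2_commute)
    also have "\<dots> \<le> (\<integral>\<^sup>+t. straddle_kernel W t y x * q t \<partial>lborel)"
      using half greater that by simp
    finally show ?thesis
      by (simp only: straddle_kernel_commute[of W _ y x])
  qed simp
  have "(\<integral>\<^sup>+x. \<integral>\<^sup>+y. ennreal ((g y - g x)\<^sup>2) \<partial>\<mu> \<partial>\<mu>)
      \<le> (\<integral>\<^sup>+x. \<integral>\<^sup>+y. \<integral>\<^sup>+t. straddle_kernel W t x y * q t \<partial>lborel \<partial>\<mu> \<partial>\<mu>)"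
  proof (rule nn_integral_mono_AE, rule eventually_mono[OF AE_in_\<Omega>], rule nn_integral_mono_AE)
    fix x assume x: "x \<in> \<Omega>"
    show "AE y in \<mu>. ennreal ((g y - g x)\<^sup>2) \<le> (\<integral>\<^sup>+t. straddle_kernel W t x y * q t \<partial>lborel)"
      using AE_in_\<Omega> by (rule eventually_mono) (use kernel_bound x in blast)
  qed
  also have "\<dots> = (\<integral>\<^sup>+x. \<integral>\<^sup>+t. \<integral>\<^sup>+y. straddle_kernel W t x y * q t \<partial>\<mu> \<partial>lborel \<partial>\<mu>)"
    by (intro nn_integral_cong L.Fubini'[symmetric]) measurable
  also have "\<dots> = (\<integral>\<^sup>+t. \<integral>\<^sup>+x. \<integral>\<^sup>+y. straddle_kernel W t x y * q t \<partial>\<mu> \<partial>\<mu> \<partial>lborel)"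
    by (intro L.Fubini'[symmetric]) measurable
  also have "\<dots> = (\<integral>\<^sup>+t. (\<integral>\<^sup>+x. \<integral>\<^sup>+y. straddle_kernel W t x y \<partial>\<mu> \<partial>\<mu>) * q t \<partial>lborel)"
    by (simp add: nn_integral_multc)
  also have "\<dots> = (\<integral>\<^sup>+t. ennreal (2 * \<phi> (F t)) * q t \<partial>lborel)"
    using nn_integral_straddle_kernel[OF pot]
    by (intro nn_integral_cong) (auto simp: q_def W_def[abs_def] split: split_indicator)
  \<comment> \<open>a factor \<open>\<rho>\<close> is split off, to pass from \<open>dt\<close> back to \<open>d\<mu>\<close>\<close>
  also have "\<dots> = (\<integral>\<^sup>+t. ennreal (\<rho> t) *
      (2 * (ennreal (\<phi> (F t) / w' (F t) / (\<rho> t)\<^sup>2 * (g' t)\<^sup>2) * indicator \<Omega> t)) \<partial>lborel)"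
  proof (intro nn_integral_cong)
    fix t
    show "ennreal (2 * \<phi> (F t)) * q t = ennreal (\<rho> t) *
      (2 * (ennreal (\<phi> (F t) / w' (F t) / (\<rho> t)\<^sup>2 * (g' t)\<^sup>2) * indicator \<Omega> t))"
    proof (cases "t \<in> \<Omega>")
      case True
      have "ennreal (2 * \<phi> (F t)) * ennreal ((g' t)\<^sup>2 / W' t)
          = ennreal (2 * \<phi> (F t) * ((g' t)\<^sup>2 / W' t))"
        using W'_pos[OF True] by (subst ennreal_mult'') auto
      also have "2 * \<phi> (F t) * ((g' t)\<^sup>2 / W' t)
          = \<rho> t * (2 * (\<phi> (F t) / w' (F t) / (\<rho> t)\<^sup>2 * (g' t)\<^sup>2))"
        using \<rho>_pos[OF True] by (simp add: W'_def field_simps power2_eq_square)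
      also have "ennreal \<dots> = ennreal (\<rho> t) * (2 * ennreal (\<phi> (F t) / w' (F t) / (\<rho> t)\<^sup>2 * (g' t)\<^sup>2))"
        using \<rho>_nonneg[of t] by (simp only: ennreal_mult' ennreal_numeral zero_le_numeral)
      finally show ?thesis using True by (simp add: q_def)
    qed (simp add: q_def)
  qed
  also have "\<dots> = (\<integral>\<^sup>+t. 2 * (ennreal (\<phi> (F t) / w' (F t) / (\<rho> t)\<^sup>2 * (g' t)\<^sup>2) * indicator \<Omega> t) \<partial>\<mu>)"
    by (intro nn_integral_\<mu>[symmetric]) measurable
  also have "\<dots> = 2 * (\<integral>\<^sup>+t\<in>\<Omega>. ennreal (\<phi> (F t) / w' (F t) / (\<rho> t)\<^sup>2 * (g' t)\<^sup>2) \<partial>\<mu>)"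
    by (intro nn_integral_cmult) measurable
  finally have "2 * ennreal ((\<integral>x. (g x)\<^sup>2 \<partial>\<mu>) - (\<integral>x. g x \<partial>\<mu>)\<^sup>2)
      \<le> 2 * (\<integral>\<^sup>+t\<in>\<Omega>. ennreal (\<phi> (F t) / w' (F t) / (\<rho> t)\<^sup>2 * (g' t)\<^sup>2) \<partial>\<mu>)"
    by (simp only: double_variance[OF assms(2) g2])
  then show ?thesis
    by (rule ennreal_mult_le_mult_iff[THEN iffD1, rotated 2]) simp_all
qed

end

section \<open>The two comparison functions\<close>

text \<open>
  Here \<open>\<phi> / w' = u (1 - u) / 2\<close>. Since \<open>w\<close> is affine, so is \<open>W = w \<circ> F\<close> as a function of \<open>F\<close>, and
  Cauchy--Schwarz is an equality for \<open>g = F\<close>: this is why the constant \<open>1/2\<close> is attained.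
\<close>

lemma potential_quadratic: "potential (\<lambda>u. u - 1/2) (\<lambda>_. 1) (\<lambda>u. u * (1 - u) / 2)"
  by standard
    (auto intro!: derivative_eq_intros continuous_intros simp: field_simps)

text \<open>
  Here \<open>\<phi> / w' = 4 u\<^sup>2 (1 - u)\<^sup>2\<close>: the function \<open>\<phi> = sqrt (u (1 - u))\<close> solves
  \<open>-4 u\<^sup>2 (1 - u)\<^sup>2 \<phi>'' = \<phi>\<close>. For the logistic distribution, whose density is \<open>F (1 - F)\<close>, this is the
  Poincare inequality with constant \<open>4\<close>.
\<close>

lemma potential_sqrt:
  "potential (\<lambda>u. (2 * u - 1) / (2 * sqrt (u * (1 - u))))
     (\<lambda>u. 1 / (4 * (u * (1 - u)) * sqrt (u * (1 - u)))) (\<lambda>u. sqrt (u * (1 - u)))"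
proof
  fix u :: real
  assume u: "0 < u" "u < 1"
  define r where "r = sqrt (u * (1 - u))"
  have p: "0 < u * (1 - u)" using u by simp
  then have r: "0 < r" and r2: "r\<^sup>2 = u * (1 - u)" by (simp_all add: r_def)
  have dr: "((\<lambda>u. sqrt (u * (1 - u))) has_real_derivative (1 - 2 * u) / (2 * r)) (at u)"
    using u p by (auto intro!: derivative_eq_intros simp: r_def field_simps)
  then show "((\<lambda>u. sqrt (u * (1 - u))) has_real_derivative
      - ((2 * u - 1) / (2 * sqrt (u * (1 - u))))) (at u)"
  proof (rule DERIV_cong)
    show "(1 - 2 * u) / (2 * r) = - ((2 * u - 1) / (2 * sqrt (u * (1 - u))))"
      unfolding r_def[symmetric] using r by (simp add: field_simps)
  qed
  have "((\<lambda>u. 2 * u - 1) has_real_derivative 2) (at u)"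
    by (auto intro!: derivative_eq_intros)
  from DERIV_divide[OF this DERIV_cmult[OF dr, of 2]] r
  have "((\<lambda>u. (2 * u - 1) / (2 * sqrt (u * (1 - u)))) has_real_derivative
      (2 * (2 * r) - (2 * u - 1) * (2 * ((1 - 2 * u) / (2 * r)))) / ((2 * r) * (2 * r))) (at u)"
    unfolding r_def[symmetric] by simp
  moreover have "(2 * (2 * r) - (2 * u - 1) * (2 * ((1 - 2 * u) / (2 * r)))) / ((2 * r) * (2 * r))
      = 1 / (4 * (u * (1 - u)) * r)"
  proof -
    have "2 * (2 * r) - (2 * u - 1) * (2 * ((1 - 2 * u) / (2 * r)))
        = (4 * r\<^sup>2 + (1 - 2 * u)\<^sup>2) / r"
      using r by (simp add: field_simps power2_eq_square)
    also have "4 * r\<^sup>2 + (1 - 2 * u)\<^sup>2 = 1"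
      unfolding r2 by (simp add: algebra_simps power2_eq_square)
    finally show ?thesis
      unfolding r2[symmetric] using r by (simp add: power2_eq_square)
  qed
  ultimately show "((\<lambda>u. (2 * u - 1) / (2 * sqrt (u * (1 - u)))) has_real_derivative
      1 / (4 * (u * (1 - u)) * sqrt (u * (1 - u)))) (at u)"
    by (simp add: r_def)
  show "0 < 1 / (4 * (u * (1 - u)) * sqrt (u * (1 - u)))"
    using p by simp
qed (auto intro!: continuous_intros)


section \<open>Quadratic forms of outer products\<close>

lemma outer_component: "outer u v $ i $ j = u $ i * v $ j"
  by (simp add: outer_def matrix_matrix_mult_def columnvector_def rowvector_def)

lemma transpose_outer_self: "transpose (outer u u) = outer u u"
  by (simp add: vec_eq_iff transpose_def outer_component mult.commute)

lemma outer_form: "v \<bullet> (outer u u *v v) = (v \<bullet> u)\<^sup>2"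
proof -
  have "outer u u *v v = (u \<bullet> v) *\<^sub>R u"
    by (simp add: vec_eq_iff matrix_vector_mult_def outer_component inner_vec_def
        sum_distrib_left sum_distrib_right mult_ac)
  then show ?thesis by (simp add: power2_eq_square inner_commute)
qed

lemma norm_outer: "norm (outer u v) = norm u * norm v"
proof -
  have "norm (outer u v $ i) = norm v * norm (u $ i)" for i
  proof -
    have "outer u v $ i = (u $ i) *\<^sub>R v"
      by (simp add: vec_eq_iff outer_component)
    then show ?thesis by simp
  qed
  then show ?thesis
    by (simp add: norm_vec_def[of "outer u v"] norm_vec_def[of u] L2_set_right_distrib mult.commute)
qed

lemma outer_scaleR: "outer (c *\<^sub>R u) (d *\<^sub>R v) = (c * d) *\<^sub>R outer u v"
  by (simp add: vec_eq_iff outer_component)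

lemma bounded_bilinear_outer: "bounded_bilinear outer"
proof
  show "\<exists>K. \<forall>a b. norm (outer a b :: real ^ 'a ^ 'a) \<le> norm a * norm b * K"
    by (intro exI[of _ 1]) (simp add: norm_outer)
qed (simp_all add: vec_eq_iff outer_component algebra_simps)

lemma borel_measurable_outer [measurable (raw)]:
  assumes "f \<in> borel_measurable M" "g \<in> borel_measurable M"
  shows "(\<lambda>x. outer (f x) (g x)) \<in> borel_measurable M"
  using assms
  by (rule borel_measurable_continuous_Pair)
     (intro bounded_bilinear.continuous_on[OF bounded_bilinear_outer] continuous_intros)

lemma bounded_linear_form: "bounded_linear (\<lambda>A :: real ^ 'n ^ 'n. v \<bullet> (A *v v))"
  unfolding linear_conv_bounded_linear[symmetric]
  by (rule linearI) (simp_all add: matrix_vector_mult_add_rdistrib inner_add_right scaleR_matrix_vector_assoc[symmetric])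

lemma bounded_linear_transpose: "bounded_linear (transpose :: real ^ 'n ^ 'n \<Rightarrow> real ^ 'n ^ 'n)"
  unfolding linear_conv_bounded_linear[symmetric]
  by (rule linearI) (simp_all add: vec_eq_iff transpose_def)

text \<open>
  All matrices of the statement are symmetric, so each Loewner inequality amounts to a scalar one
  for the functions \<open>x \<mapsto> v \<bullet> f(x)\<close>.
\<close>

lemma loewner_le_iff_form:
  assumes "transpose A = A" "transpose B = B"
  shows "A \<preceq>\<^sub>L B \<longleftrightarrow> (\<forall>v. v \<bullet> (A *v v) \<le> v \<bullet> (B *v v))"
proof -
  have "transpose (B - A) = B - A"
    using assms linear_diff[OF bounded_linear.linear[OF bounded_linear_transpose], of B A] by simp
  then show ?thesis
    by (simp add: loewner_le_def psd_def matrix_vector_mult_diff_rdistrib inner_diff_right)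
qed

text \<open>
  The weight \<open>k\<close> is \<open>F (1 - F) / \<rho>\<^sup>2\<close> in the weighted inequality and \<open>1\<close> in the other applications.
\<close>

lemma form_integral_outer:
  assumes "integrable M (\<lambda>x. k x *\<^sub>R outer (h x) (h x))"
  shows "v \<bullet> ((\<integral>x. k x *\<^sub>R outer (h x) (h x) \<partial>M) *v v) = (\<integral>x. k x * (v \<bullet> h x)\<^sup>2 \<partial>M)"
    and "integrable M (\<lambda>x. k x * (v \<bullet> h x)\<^sup>2)"
    and "transpose (\<integral>x. k x *\<^sub>R outer (h x) (h x) \<partial>M) = (\<integral>x. k x *\<^sub>R outer (h x) (h x) \<partial>M)"
  using integral_bounded_linear[OF bounded_linear_form assms, of v]
    integrable_bounded_linear[OF bounded_linear_form assms, of v]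
    integral_bounded_linear[OF bounded_linear_transpose assms]
  by (simp_all add: scaleR_matrix_vector_assoc[symmetric] outer_form
      linear_cmul[OF bounded_linear.linear[OF bounded_linear_transpose]] transpose_outer_self)

lemma integrable_outer:
  assumes [measurable]: "h \<in> borel_measurable M" and "integrable M (\<lambda>x. (norm (h x))\<^sup>2)"
  shows "integrable M (\<lambda>x. outer (h x) (h x))"
  using assms(2) by (rule Bochner_Integration.integrable_bound) (auto simp: norm_outer power2_eq_square)

section \<open>The matrix inequalities\<close>

context interval_density
begin

lemma set_integral_\<Omega>:
  fixes h :: "real \<Rightarrow> 'b :: {banach, second_countable_topology}"
  assumes [measurable]: "h \<in> borel_measurable borel"
  shows "(LINT x:\<Omega>|\<mu>. h x) = (\<integral>x. h x \<partial>\<mu>)"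
  unfolding set_lebesgue_integral_def
  by (rule integral_cong_AE) (use AE_in_\<Omega> in auto)

lemma set_integrable_\<Omega>:
  fixes h :: "real \<Rightarrow> 'b :: {banach, second_countable_topology}"
  assumes [measurable]: "h \<in> borel_measurable borel"
  shows "set_integrable \<mu> \<Omega> h \<longleftrightarrow> integrable \<mu> h"
  unfolding set_integrable_def
  by (rule integrable_cong_AE) (use AE_in_\<Omega> in auto)

lemma nn_set_integral_\<Omega>: "(\<integral>\<^sup>+x\<in>\<Omega>. h x \<partial>\<mu>) = (\<integral>\<^sup>+x. h x \<partial>\<mu>)"
  by (rule nn_integral_cong_AE) (use AE_in_\<Omega> in auto)

lemma weight_borel [measurable]: "weight \<mu> \<rho> \<in> borel_measurable borel"
  unfolding weight_def by measurable

lemma weight_nonneg: "0 \<le> weight \<mu> \<rho> x"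
  using cdf_nonneg[of x] cdf_bounded_prob[of x] by (simp add: weight_def)

lemma matrix_variance_eq:
  assumes [measurable]: "f \<in> borel_measurable borel"
  shows "matrix_variance \<mu> \<Omega> f =
    (\<integral>x. 1 *\<^sub>R outer (f x) (f x) \<partial>\<mu>) - outer (\<integral>x. f x \<partial>\<mu>) (\<integral>x. f x \<partial>\<mu>)"
  by (simp add: matrix_variance_def set_integral_\<Omega>)

lemma integrable_of_norm_square:
  fixes f :: "real \<Rightarrow> real ^ 'n"
  assumes [measurable]: "f \<in> borel_measurable borel" and "integrable \<mu> (\<lambda>x. (norm (f x))\<^sup>2)"
  shows "integrable \<mu> f"
  using square_integrable_imp_integrable[OF _ assms(2)] by (simp add: integrable_norm_iff)

lemma matrix_variance_form:
  assumes [measurable]: "f \<in> borel_measurable borel" and f2: "integrable \<mu> (\<lambda>x. (norm (f x))\<^sup>2)"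
  shows "v \<bullet> (matrix_variance \<mu> \<Omega> f *v v) = (\<integral>x. (v \<bullet> f x)\<^sup>2 \<partial>\<mu>) - (\<integral>x. v \<bullet> f x \<partial>\<mu>)\<^sup>2"
    and "transpose (matrix_variance \<mu> \<Omega> f) = matrix_variance \<mu> \<Omega> f"
proof -
  have int: "integrable \<mu> (\<lambda>x. 1 *\<^sub>R outer (f x) (f x))"
    using integrable_outer[of f \<mu>] f2 by simp
  have "(\<integral>x. v \<bullet> f x \<partial>\<mu>) = v \<bullet> (\<integral>x. f x \<partial>\<mu>)"
    by (rule integral_inner_right) (use integrable_of_norm_square[OF assms(1) f2] in simp)
  then show "v \<bullet> (matrix_variance \<mu> \<Omega> f *v v) = (\<integral>x. (v \<bullet> f x)\<^sup>2 \<partial>\<mu>) - (\<integral>x. v \<bullet> f x \<partial>\<mu>)\<^sup>2"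
    unfolding matrix_variance_eq[OF assms(1)] matrix_vector_mult_diff_rdistrib inner_diff_right
      form_integral_outer(1)[OF int] outer_form by simp
  show "transpose (matrix_variance \<mu> \<Omega> f) = matrix_variance \<mu> \<Omega> f"
    unfolding matrix_variance_eq[OF assms(1)]
      linear_diff[OF bounded_linear.linear[OF bounded_linear_transpose]]
      form_integral_outer(3)[OF int] transpose_outer_self ..
qed

lemma matrix_variance_form_le:
  assumes pot: "potential w w' \<phi>"
    and [measurable]: "f \<in> borel_measurable borel" "f' \<in> borel_measurable borel"
    and deriv: "\<And>x. x \<in> \<Omega> \<Longrightarrow> (f has_vector_derivative f' x) (at x)"
    and f2: "integrable \<mu> (\<lambda>x. (norm (f x))\<^sup>2)"
  shows "ennreal (v \<bullet> (matrix_variance \<mu> \<Omega> f *v v))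
       \<le> (\<integral>\<^sup>+x\<in>\<Omega>. ennreal (\<phi> (F x) / w' (F x) / (\<rho> x)\<^sup>2 * (v \<bullet> f' x)\<^sup>2) \<partial>\<mu>)"
proof -
  have "integrable \<mu> (\<lambda>x. (v \<bullet> f x)\<^sup>2)"
    using form_integral_outer(2)[of \<mu> "\<lambda>_. 1" f v] integrable_outer[of f \<mu>] f2 by simp
  moreover have "((\<lambda>x. v \<bullet> f x) has_real_derivative v \<bullet> f' x) (at x)" if "x \<in> \<Omega>" for x
    unfolding has_real_derivative_iff_has_vector_derivative
    by (rule bounded_linear.has_vector_derivative[OF bounded_linear_inner_right deriv[OF that]])
  ultimately show ?thesis
    unfolding matrix_variance_form(1)[OF assms(2) f2]
    by (intro variance_le_weighted_energy[OF pot]) auto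
qed

theorem weighted_poincare_inequality:
  assumes [measurable]: "f \<in> borel_measurable borel" "f' \<in> borel_measurable borel"
    and deriv: "\<And>x. x \<in> \<Omega> \<Longrightarrow> (f has_vector_derivative f' x) (at x)"
    and f2: "integrable \<mu> (\<lambda>x. (norm (f x))\<^sup>2)"
  shows "weighted_poincare \<mu> \<rho> \<Omega> f f'"
proof -
  let ?E = "\<lambda>v. \<integral>\<^sup>+x. ennreal (weight \<mu> \<rho> x * (v \<bullet> f' x)\<^sup>2) \<partial>\<mu>"
  have main: "ennreal (v \<bullet> (matrix_variance \<mu> \<Omega> f *v v)) \<le> ennreal (1/2) * ?E v" for v
  proof -
    have "ennreal (v \<bullet> (matrix_variance \<mu> \<Omega> f *v v))
        \<le> (\<integral>\<^sup>+x. ennreal (F x * (1 - F x) / 2 / 1 / (\<rho> x)\<^sup>2 * (v \<bullet> f' x)\<^sup>2) \<partial>\<mu>)"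
      using matrix_variance_form_le[OF potential_quadratic assms(1,2) deriv f2]
      unfolding nn_set_integral_\<Omega> .
    also have "\<dots> = (\<integral>\<^sup>+x. ennreal (1/2) * ennreal (weight \<mu> \<rho> x * (v \<bullet> f' x)\<^sup>2) \<partial>\<mu>)"
      by (intro nn_integral_cong, subst ennreal_mult'[symmetric]) (auto simp: weight_def)
    also have "\<dots> = ennreal (1/2) * ?E v"
      by (rule nn_integral_cmult) measurable
    finally show ?thesis .
  qed
  moreover have "matrix_variance \<mu> \<Omega> f \<preceq>\<^sub>L (1/2) *\<^sub>R (LINT x:\<Omega>|\<mu>. weight \<mu> \<rho> x *\<^sub>R outer (f' x) (f' x))"
    if "set_integrable \<mu> \<Omega> (\<lambda>x. weight \<mu> \<rho> x *\<^sub>R outer (f' x) (f' x))"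
  proof -
    have int: "integrable \<mu> (\<lambda>x. weight \<mu> \<rho> x *\<^sub>R outer (f' x) (f' x))"
      using that by (simp add: set_integrable_\<Omega>)
    have "v \<bullet> (matrix_variance \<mu> \<Omega> f *v v) \<le> 1/2 * (\<integral>x. weight \<mu> \<rho> x * (v \<bullet> f' x)\<^sup>2 \<partial>\<mu>)" for v
    proof -
      have "?E v = ennreal (\<integral>x. weight \<mu> \<rho> x * (v \<bullet> f' x)\<^sup>2 \<partial>\<mu>)"
        using form_integral_outer(2)[OF int] weight_nonneg by (intro nn_integral_eq_integral) auto
      then have "ennreal (v \<bullet> (matrix_variance \<mu> \<Omega> f *v v))
          \<le> ennreal (1/2 * (\<integral>x. weight \<mu> \<rho> x * (v \<bullet> f' x)\<^sup>2 \<partial>\<mu>))"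
        using main[of v] by (subst ennreal_mult') auto
      then show ?thesis
        using weight_nonneg by (subst (asm) ennreal_le_iff) (auto intro!: Bochner_Integration.integral_nonneg)
    qed
    then show ?thesis
      using form_integral_outer(1,3)[OF int] matrix_variance_form(2)[OF assms(1) f2]
      by (subst loewner_le_iff_form)
         (simp_all add: set_integral_\<Omega> scaleR_matrix_vector_assoc[symmetric]
           linear_cmul[OF bounded_linear.linear[OF bounded_linear_transpose]])
  qed
  ultimately show ?thesis
    by (simp add: weighted_poincare_def outer_form nn_set_integral_\<Omega>)
qed

text \<open>
  Each of the two weights \<open>\<phi>(F) / (w'(F) \<rho>\<^sup>2)\<close> is bounded by its supremum. Working in \<open>ennreal\<close>
  covers an infinite supremum as well: there \<open>\<infinity> \<cdot> 0 = 0\<close> says that zero energy forces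
  zero variance.
\<close>

theorem sup_poincare_inequality:
  assumes [measurable]: "f \<in> borel_measurable borel" "f' \<in> borel_measurable borel"
    and deriv: "\<And>x. x \<in> \<Omega> \<Longrightarrow> (f has_vector_derivative f' x) (at x)"
    and f2: "integrable \<mu> (\<lambda>x. (norm (f x))\<^sup>2)" and f'2: "integrable \<mu> (\<lambda>x. (norm (f' x))\<^sup>2)"
  shows "sup_poincare \<mu> \<rho> \<Omega> f f'"
proof -
  let ?C = "poincare_const \<mu> \<rho> \<Omega>"
  let ?e = "\<lambda>v x. ennreal ((v \<bullet> f' x)\<^sup>2)"
  have le_of_pointwise: "ennreal (v \<bullet> (matrix_variance \<mu> \<Omega> f *v v)) \<le> c * (\<integral>\<^sup>+x. ?e v x \<partial>\<mu>)"
    if "potential w w' \<phi>" and c: "\<And>x. x \<in> \<Omega> \<Longrightarrow> ennreal (\<phi> (F x) / w' (F x) / (\<rho> x)\<^sup>2) \<le> c"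
    for v c w w' \<phi>
  proof -
    have "ennreal (v \<bullet> (matrix_variance \<mu> \<Omega> f *v v))
        \<le> (\<integral>\<^sup>+x\<in>\<Omega>. ennreal (\<phi> (F x) / w' (F x) / (\<rho> x)\<^sup>2 * (v \<bullet> f' x)\<^sup>2) \<partial>\<mu>)"
      by (rule matrix_variance_form_le[OF that(1) assms(1,2) deriv f2])
    also have "\<dots> \<le> (\<integral>\<^sup>+x\<in>\<Omega>. c * ?e v x \<partial>\<mu>)"
    proof (rule nn_integral_mono)
      fix x
      have "ennreal (\<phi> (F x) / w' (F x) / (\<rho> x)\<^sup>2 * (v \<bullet> f' x)\<^sup>2)
          = ennreal (\<phi> (F x) / w' (F x) / (\<rho> x)\<^sup>2) * ?e v x"
        by (rule ennreal_mult'') simp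
      also have "\<dots> * indicator \<Omega> x \<le> c * ?e v x * indicator \<Omega> x"
        using mult_right_mono[OF c, of x "?e v x"] by (cases "x \<in> \<Omega>") auto
      finally show "ennreal (\<phi> (F x) / w' (F x) / (\<rho> x)\<^sup>2 * (v \<bullet> f' x)\<^sup>2) * indicator \<Omega> x
          \<le> c * ?e v x * indicator \<Omega> x" .
    qed
    also have "\<dots> = c * (\<integral>\<^sup>+x. ?e v x \<partial>\<mu>)"
      unfolding nn_set_integral_\<Omega> by (rule nn_integral_cmult) measurable
    finally show ?thesis .
  qed
  have int: "integrable \<mu> (\<lambda>x. 1 *\<^sub>R outer (f' x) (f' x))"
    using integrable_outer[of f' \<mu>] f'2 by simp
  have energy: "(\<integral>\<^sup>+x. ?e v x \<partial>\<mu>) = ennreal (v \<bullet> ((LINT x:\<Omega>|\<mu>. outer (f' x) (f' x)) *v v))" for v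
    using form_integral_outer(1,2)[OF int, of v]
    by (simp add: nn_integral_eq_integral set_integral_\<Omega>)
  have main: "ennreal (v \<bullet> (matrix_variance \<mu> \<Omega> f *v v))
      \<le> ?C * ennreal (v \<bullet> ((LINT x:\<Omega>|\<mu>. outer (f' x) (f' x)) *v v))" for v
  proof -
    let ?S = "SUP x\<in>\<Omega>. ennreal (F x * (1 - F x) / (\<rho> x)\<^sup>2)"
    let ?K = "SUP x\<in>\<Omega>. ennreal (F x * (1 - F x) / \<rho> x)"
    have "ennreal (v \<bullet> (matrix_variance \<mu> \<Omega> f *v v)) \<le> ennreal (1/2) * ?S * (\<integral>\<^sup>+x. ?e v x \<partial>\<mu>)"
    proof (rule le_of_pointwise[OF potential_quadratic])
      fix x assume "x \<in> \<Omega>"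
      then have "ennreal (1/2) * ennreal (F x * (1 - F x) / (\<rho> x)\<^sup>2) \<le> ennreal (1/2) * ?S"
        by (intro mult_left_mono SUP_upper) auto
      then show "ennreal (F x * (1 - F x) / 2 / 1 / (\<rho> x)\<^sup>2) \<le> ennreal (1/2) * ?S"
        by (subst (asm) ennreal_mult'[symmetric]) auto
    qed
    moreover have "ennreal (v \<bullet> (matrix_variance \<mu> \<Omega> f *v v)) \<le> 4 * ?K\<^sup>2 * (\<integral>\<^sup>+x. ?e v x \<partial>\<mu>)"
    proof (rule le_of_pointwise[OF potential_sqrt])
      fix x assume x: "x \<in> \<Omega>"
      define p where "p = F x * (1 - F x)"
      have p: "0 < p" using F_bounds[OF x] by (simp add: p_def)
      have "sqrt p / (1 / (4 * p * sqrt p)) / (\<rho> x)\<^sup>2 = 4 * (p / \<rho> x)\<^sup>2"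
        using p by (simp add: power_divide power2_eq_square)
      also have "ennreal \<dots> = 4 * (ennreal (p / \<rho> x))\<^sup>2"
        using p \<rho>_pos[OF x] by (simp add: ennreal_mult' ennreal_power)
      also have "\<dots> \<le> 4 * ?K\<^sup>2"
        using x unfolding p_def by (intro mult_left_mono power_mono SUP_upper) auto
      finally show "ennreal (sqrt (F x * (1 - F x)) / (1 / (4 * (F x * (1 - F x)) * sqrt (F x * (1 - F x)))) /
          (\<rho> x)\<^sup>2) \<le> 4 * ?K\<^sup>2"
        unfolding p_def .
    qed
    ultimately show ?thesis
      unfolding energy[symmetric] poincare_const_def min_def by (simp only: split: if_split) blast
  qed
  moreover have "matrix_variance \<mu> \<Omega> f \<preceq>\<^sub>L enn2real ?C *\<^sub>R (LINT x:\<Omega>|\<mu>. outer (f' x) (f' x))"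
    if "?C < \<infinity>"
  proof -
    have C: "?C = ennreal (enn2real ?C)"
      using that by simp
    have "v \<bullet> (matrix_variance \<mu> \<Omega> f *v v)
        \<le> enn2real ?C * (v \<bullet> ((LINT x:\<Omega>|\<mu>. outer (f' x) (f' x)) *v v))" for v
    proof -
      have nonneg: "0 \<le> v \<bullet> ((LINT x:\<Omega>|\<mu>. outer (f' x) (f' x)) *v v)"
        using form_integral_outer(1)[OF int, of v] by (simp add: set_integral_\<Omega>)
      have "ennreal (v \<bullet> (matrix_variance \<mu> \<Omega> f *v v))
          \<le> ennreal (enn2real ?C * (v \<bullet> ((LINT x:\<Omega>|\<mu>. outer (f' x) (f' x)) *v v)))"
        using main[of v] by (simp only: ennreal_mult'[OF enn2real_nonneg] C[symmetric])
      then show ?thesis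
        using nonneg by (subst (asm) ennreal_le_iff) auto
    qed
    then show ?thesis
      using form_integral_outer(3)[OF int] matrix_variance_form(2)[OF assms(1) f2]
      by (subst loewner_le_iff_form)
         (simp_all add: set_integral_\<Omega> scaleR_matrix_vector_assoc[symmetric]
           linear_cmul[OF bounded_linear.linear[OF bounded_linear_transpose]])
  qed
  ultimately show ?thesis
    unfolding sup_poincare_def by blast
qed

text \<open>
  Since \<open>F\<close> is uniformly distributed, its variance is \<open>1/3 - 1/4 = 1/12\<close>, while the weight cancels the
  square of the derivative \<open>\<rho>\<close> and leaves the energy \<open>1/2 - 1/3 = 1/6\<close>.
\<close>

theorem cdf_attains_weighted_poincare:
  fixes e :: "real ^ 'n"
  assumes "e \<noteq> 0"
  shows "weighted_poincare_attained \<mu> \<rho> \<Omega> (\<lambda>x. F x *\<^sub>R e) (\<lambda>x. \<rho> x *\<^sub>R e)"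
proof -
  have d1: "((\<lambda>u. u\<^sup>2 / 2) has_real_derivative u) (at u)"
    and d2: "((\<lambda>u. u ^ 3 / 3) has_real_derivative u\<^sup>2) (at u)" for u :: real
    by (rule DERIV_cong[OF DERIV_cdivide[OF DERIV_pow]], simp add: numeral_eq_Suc)+
  have m1: "integrable \<mu> F" "(\<integral>x. F x \<partial>\<mu>) = 1/2"
    using integral_comp_F[OF d1] by (simp_all add: continuous_on_id)
  have m2: "integrable \<mu> (\<lambda>x. (F x)\<^sup>2)" "(\<integral>x. (F x)\<^sup>2 \<partial>\<mu>) = 1/3"
    using integral_comp_F[OF d2] by (simp_all add: continuous_on_power)
  have variance: "matrix_variance \<mu> \<Omega> (\<lambda>x. F x *\<^sub>R e) = (1/12) *\<^sub>R outer e e"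
  proof -
    have "(\<integral>x. (F x * F x) *\<^sub>R outer e e \<partial>\<mu>) = (1/3) *\<^sub>R outer e e"
      using m2 by (simp add: power2_eq_square)
    moreover have "(\<integral>x. F x *\<^sub>R e \<partial>\<mu>) = (1/2) *\<^sub>R e"
      using m1 by simp
    ultimately show ?thesis
      by (simp add: matrix_variance_eq outer_scaleR scaleR_diff_left[symmetric])
  qed
  have energy_AE: "AE x in \<mu>. weight \<mu> \<rho> x *\<^sub>R outer (\<rho> x *\<^sub>R e) (\<rho> x *\<^sub>R e) = (F x - (F x)\<^sup>2) *\<^sub>R outer e e"
    using AE_in_\<Omega>
  proof (rule eventually_mono)
    fix x assume "x \<in> \<Omega>"
    then have "weight \<mu> \<rho> x * (\<rho> x)\<^sup>2 = F x * (1 - F x)"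
      using \<rho>_pos[of x] by (simp add: weight_def)
    then have "weight \<mu> \<rho> x * (\<rho> x * \<rho> x) = F x - (F x)\<^sup>2"
      by (simp only: power2_eq_square right_diff_distrib mult_1_right)
    then show "weight \<mu> \<rho> x *\<^sub>R outer (\<rho> x *\<^sub>R e) (\<rho> x *\<^sub>R e) = (F x - (F x)\<^sup>2) *\<^sub>R outer e e"
      by (simp add: outer_scaleR)
  qed
  have energy_int: "integrable \<mu> (\<lambda>x. weight \<mu> \<rho> x *\<^sub>R outer (\<rho> x *\<^sub>R e) (\<rho> x *\<^sub>R e))"
    using m1 m2 by (subst integrable_cong_AE[OF _ _ energy_AE]) auto
  have "(\<integral>x. weight \<mu> \<rho> x *\<^sub>R outer (\<rho> x *\<^sub>R e) (\<rho> x *\<^sub>R e) \<partial>\<mu>) = (\<integral>x. (F x - (F x)\<^sup>2) *\<^sub>R outer e e \<partial>\<mu>)"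
    by (rule integral_cong_AE[OF _ _ energy_AE]) auto
  also have "\<dots> = (1/6) *\<^sub>R outer e e"
    using m1 m2 by simp
  finally have energy: "(\<integral>x. weight \<mu> \<rho> x *\<^sub>R outer (\<rho> x *\<^sub>R e) (\<rho> x *\<^sub>R e) \<partial>\<mu>) = (1/6) *\<^sub>R outer e e" .
  have "outer e e \<noteq> 0"
    using norm_outer[of e e] assms by auto
  then show ?thesis
    unfolding weighted_poincare_attained_def variance
    using m2(1) energy_int energy F_deriv
    by (auto simp: set_integrable_\<Omega> set_integral_\<Omega> power_mult_distrib
        intro!: has_vector_derivative_scaleR[THEN has_vector_derivative_eq_rhs]
          has_vector_derivative_const)
qed

end

theorem corollary3p2:
  fixes \<mu> :: "real measure" and \<rho> :: "real \<Rightarrow> real" and \<Omega> :: "real set"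
    and f f' :: "real \<Rightarrow> real ^ 'n"
  assumes "prob_space \<mu>"
    and "\<mu> = density lborel (\<lambda>x. ennreal (\<rho> x))"
    and "open \<Omega>" and "connected \<Omega>"
    and "continuous_on \<Omega> \<rho>"
    and "\<And>x. x \<in> \<Omega> \<Longrightarrow> 0 < \<rho> x" and "\<And>x. x \<notin> \<Omega> \<Longrightarrow> \<rho> x = 0"
    and "f \<in> borel_measurable borel"
    and "\<And>x. x \<in> \<Omega> \<Longrightarrow> (f has_vector_derivative f' x) (at x)"
    and "f' \<in> borel_measurable borel"
    and "set_integrable \<mu> \<Omega> (\<lambda>x. (norm (f x))\<^sup>2)"
    and "set_integrable \<mu> \<Omega> (\<lambda>x. (norm (f' x))\<^sup>2)"
  shows "(weighted_poincare \<mu> \<rho> \<Omega> f f' \<and>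
           (\<exists>f\<^sub>0 f\<^sub>0' :: real \<Rightarrow> real ^ 'n. weighted_poincare_attained \<mu> \<rho> \<Omega> f\<^sub>0 f\<^sub>0')) \<and>
         sup_poincare \<mu> \<rho> \<Omega> f f'"
proof -
  have "sets \<mu> = sets borel"
    using assms(2) by simp
  then interpret interval_density \<mu> \<rho> \<Omega>
    using assms(1-7)
    by (intro interval_density.intro interval_density_axioms.intro real_distribution.intro
        real_distribution_axioms.intro)
  have f2: "integrable \<mu> (\<lambda>x. (norm (f x))\<^sup>2)" and f'2: "integrable \<mu> (\<lambda>x. (norm (f' x))\<^sup>2)"
    using assms(8,10-12) by (simp_all add: set_integrable_\<Omega>)
  show ?thesis
    using weighted_poincare_inequality[OF assms(8,10,9) f2]
      sup_poincare_inequality[OF assms(8,10,9) f2 f'2]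
      cdf_attains_weighted_poincare[of "1 :: real ^ 'n"]
    by (metis zero_neq_one)
qed

end
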